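(* Let $g$ be a $G$-invariant, $J$-invariant Riemannian structure on $M$, let $\Delta_{LB}$ be the corresponding Laplace-Beltrami operator, and give $\Lambda^{0,1}$ the Hermitian structure associated to $g$. Then the intrinsic metric $d_\square$ is equivalent to the intrinsic metric $d_{LB}$ of $-\Delta_{LB}$ on functions; that is, there are constants $c,C>0$ such that $c\,d_{LB}(x,y)\le d_\square(x,y)\le C\,d_{LB}(x,y)$ for all $x,y\in M$.
   Context: Setting. $M$ is a complex manifold with smooth nonempty boundary $bM$, $\bar M=M\cup bM$, with $\bar M$ a closed subset of a complex manifold $\widetilde M$ of the same dimension whose complex structure extends that of $M$, every point of $\bar M$ being an interior point of $\widetilde M$. There is a smooth $\rho:\widetilde M\to\mathbb R$ with $M=\{\rho<0\}$, $bM=\{\rho=0\}$, $d\rho\ne0$ on $bM$. $M$ is strongly pseudoconvex: for each $x\in bM$ the Levi form $L_x(w,\bar w)=\sum_{j,k}\frac{\partial^2\rho}{\partial z^j\partial\bar z^k}(x)w^j\bar w^k$ is positive definite on $\{w\in\mathbb C^n:\sum_k\frac{\partial\rho}{\partial z^k}(x)w^k=0\}$, $n=\dim_{\mathbb C}M$. A Lie group $G$ acts freely on $\bar M$ by holomorphic transformations so that $G\to M\to X$ is a principal bundle with compact orbit space $\bar M/G$. $J:TM\to TM$ is the complex structure; $J$-invariance of $g$ means $g(JX,JY)=g(X,Y)$. The Hermitian structure associated to $g$ on $T_{0,1}=\{X+iJX\}$ is $\langle X+iJX,Y+iJY\rangle_{T_{0,1}}=g(X,Y)+ig(JX,Y)$,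 and on $\Lambda^{0,1}$ (the bundle of $(0,1)$-forms) it is the one obtained by duality. $d_\square(x,y)=\sup\{w(y)-w(x)\mid w\in L^\infty\cap C^\infty(\bar M,\mathbb R),\ \langle\bar\partial w,\bar\partial w\rangle_{\Lambda^{0,1}}\le1\}$, where $C^\infty(\bar M,\mathbb R)$ denotes real functions smooth up to the boundary. The Laplace-Beltrami operator on functions is induced by the quadratic form $w\mapsto\int\langle dw,dw\rangle_{\Lambda^1}$, and its intrinsic metric is $d_{LB}(x,y)=\sup\{w(y)-w(x)\mid w\in L^\infty\cap C^\infty(\bar M,\mathbb R),\ \langle dw,dw\rangle_{\Lambda^1}\le1\}$, where $\langle\cdot,\cdot\rangle_{\Lambda^1}$ is the metric on $1$-forms induced by $g$. *)

theory Defs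
  imports "HOL-Analysis.Analysis" "HOL-Algebra.Group_Action"
begin

section \<open>Calculus in normed spaces\<close>

text \<open>Only used on open sets and for functions between finite-dimensional spaces, where
  this is the usual notion of a \<open>k\<close> times continuously differentiable function.\<close>

primrec Ck_on ::
  "nat \<Rightarrow> 'a set \<Rightarrow> ('a::real_normed_vector \<Rightarrow> 'b::real_normed_vector) \<Rightarrow> bool" where
  "Ck_on 0 S f \<longleftrightarrow> continuous_on S f"
| "Ck_on (Suc k) S f \<longleftrightarrow> (\<forall>x\<in>S. f differentiable (at x)) \<and>
     (\<forall>v. Ck_on k S (\<lambda>x. frechet_derivative f (at x) v))"

definition smooth_on ::
  "'a set \<Rightarrow> ('a::real_normed_vector \<Rightarrow> 'b::real_normed_vector) \<Rightarrow> bool" where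
  "smooth_on S f \<longleftrightarrow> (\<forall>k. Ck_on k S f)"

definition vec_holomorphic_on ::
  "(complex ^ 'n) set \<Rightarrow> (complex ^ 'n \<Rightarrow> complex ^ 'm) \<Rightarrow> bool" where
  "vec_holomorphic_on S f \<longleftrightarrow>
     (\<forall>z\<in>S. \<exists>D. (f has_derivative D) (at z) \<and> (\<forall>a v. D (a *s v) = a *s D v))"

definition wirtinger_z :: "'n \<Rightarrow> (complex ^ 'n \<Rightarrow> complex) \<Rightarrow> complex ^ 'n \<Rightarrow> complex" where
  "wirtinger_z k f z =
     (frechet_derivative f (at z) (axis k 1) - \<i> * frechet_derivative f (at z) (axis k \<i>)) / 2"

definition wirtinger_zbar :: "'n \<Rightarrow> (complex ^ 'n \<Rightarrow> complex) \<Rightarrow> complex ^ 'n \<Rightarrow> complex" where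
  "wirtinger_zbar k f z =
     (frechet_derivative f (at z) (axis k 1) + \<i> * frechet_derivative f (at z) (axis k \<i>)) / 2"

section \<open>Manifolds\<close>

text \<open>A manifold is a topological type together with an atlas, not assumed to be maximal.
  A chart is a pair of its domain and a map whose values off the domain are irrelevant.
  The model space is any finite-dimensional normed space; unlike \<open>euclidean_space\<close>,
  this permits dimension \<open>0\<close>, which is needed for discrete Lie groups.\<close>

type_synonym ('m, 'e) chart = "'m set \<times> ('m \<Rightarrow> 'e)"

definition is_chart :: "('m::topological_space, 'e::real_normed_vector) chart \<Rightarrow> bool" where
  "is_chart c \<longleftrightarrow> open (fst c) \<and> open (snd c ` fst c) \<and>
     homeomorphism (fst c) (snd c ` fst c) (snd c) (inv_into (fst c) (snd c))"

definition in_chart :: "('m, 'e) chart \<Rightarrow> ('m \<Rightarrow> 'b) \<Rightarrow> 'e \<Rightarrow> 'b" where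
  "in_chart c f = f \<circ> inv_into (fst c) (snd c)"

abbreviation transition :: "('m, 'e) chart \<Rightarrow> ('m, 'e) chart \<Rightarrow> 'e \<Rightarrow> 'e" where
  "transition c c' \<equiv> in_chart c (snd c')"

definition topological_atlas ::
  "('m::topological_space, 'e::real_normed_vector) chart set \<Rightarrow> bool" where
  "topological_atlas A \<longleftrightarrow> (\<exists>B :: 'e set. finite B \<and> span B = UNIV) \<and>
     (\<forall>c\<in>A. is_chart c) \<and> (\<Union>c\<in>A. fst c) = UNIV"

definition smooth_atlas ::
  "('m::topological_space, 'e::real_normed_vector) chart set \<Rightarrow> bool" where
  "smooth_atlas A \<longleftrightarrow> topological_atlas A \<and>
     (\<forall>c\<in>A. \<forall>c'\<in>A. smooth_on (snd c ` (fst c \<inter> fst c')) (transition c c'))"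

definition complex_atlas :: "('m::topological_space, complex ^ 'n) chart set \<Rightarrow> bool" where
  "complex_atlas A \<longleftrightarrow> topological_atlas A \<and>
     (\<forall>c\<in>A. \<forall>c'\<in>A. vec_holomorphic_on (snd c ` (fst c \<inter> fst c')) (transition c c'))"

definition product_atlas ::
  "('m, 'e) chart set \<Rightarrow> ('k, 'f) chart set \<Rightarrow> ('m \<times> 'k, 'e \<times> 'f) chart set" where
  "product_atlas A B =
     {(fst c \<times> fst d, map_prod (snd c) (snd d)) | c d. c \<in> A \<and> d \<in> B}"

abbreviation real_atlas :: "(real, real) chart set" where
  "real_atlas \<equiv> {(UNIV, \<lambda>t. t)}"

text \<open>Smoothness on an arbitrary subset \<open>S\<close>: near each point of \<open>S\<close> the map extends, in
  charts, to a smooth map on an open set. For the closure of a domain with smooth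
  boundary this is smoothness up to the boundary.\<close>

definition smooth_map_on ::
  "('m::topological_space, 'e::real_normed_vector) chart set \<Rightarrow>
   ('k::topological_space, 'f::real_normed_vector) chart set \<Rightarrow> 'm set \<Rightarrow> ('m \<Rightarrow> 'k) \<Rightarrow> bool" where
  "smooth_map_on A B S f \<longleftrightarrow>
     (\<forall>p\<in>S. \<exists>c\<in>A. \<exists>d\<in>B. \<exists>W F. open W \<and> p \<in> W \<and> W \<subseteq> fst c \<and> f ` (W \<inter> S) \<subseteq> fst d \<and>
        smooth_on (snd c ` W) F \<and> (\<forall>x\<in>W \<inter> S. F (snd c x) = snd d (f x)))"

definition holomorphic_map_on ::
  "('m::topological_space, complex ^ 'n) chart set \<Rightarrow>
   ('k::topological_space, complex ^ 'l) chart set \<Rightarrow> 'm set \<Rightarrow> ('m \<Rightarrow> 'k) \<Rightarrow> bool" where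
  "holomorphic_map_on A B S f \<longleftrightarrow> continuous_on S f \<and>
     (\<forall>c\<in>A. \<forall>d\<in>B. vec_holomorphic_on (snd c ` {x \<in> fst c \<inter> S. f x \<in> fst d}) (in_chart c (snd d \<circ> f)))"

section \<open>Tangent vectors\<close>

text \<open>A tangent vector at \<open>p\<close> assigns to every chart around \<open>p\<close> its coordinate vector,
  subject to the transformation law; the vector space operations are pointwise. The
  value \<open>0\<close> at all other pairs makes the representation unique.\<close>

type_synonym ('m, 'e) tangent = "('m, 'e) chart \<Rightarrow> 'e"

definition charts_at :: "('m, 'e) chart set \<Rightarrow> 'm \<Rightarrow> ('m, 'e) chart set" where
  "charts_at A p = {c \<in> A. p \<in> fst c}"

definition tangent_space ::
  "('m, 'e::real_normed_vector) chart set \<Rightarrow> 'm \<Rightarrow> ('m, 'e) tangent set" where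
  "tangent_space A p = {X.
     (\<forall>c\<in>charts_at A p. \<forall>c'\<in>charts_at A p.
        X c' = frechet_derivative (transition c c') (at (snd c p)) (X c)) \<and>
     (\<forall>c. c \<notin> charts_at A p \<longrightarrow> X c = 0)}"

definition tangent_of_coords ::
  "('m, 'e::real_normed_vector) chart set \<Rightarrow> ('m, 'e) chart \<Rightarrow> 'm \<Rightarrow> 'e \<Rightarrow> ('m, 'e) tangent" where
  "tangent_of_coords A c p u = (\<lambda>c'. if c' \<in> charts_at A p
     then frechet_derivative (transition c c') (at (snd c p)) u else 0)"

text \<open>The results of the next two definitions do not depend on the choice of chart.\<close>

definition differential ::
  "('m, 'e::real_normed_vector) chart set \<Rightarrow> ('m \<Rightarrow> real) \<Rightarrow> 'm \<Rightarrow> ('m, 'e) tangent \<Rightarrow> real" where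
  "differential A f p X = (let c = (SOME c. c \<in> charts_at A p)
     in frechet_derivative (in_chart c f) (at (snd c p)) (X c))"

definition pushforward ::
  "('m, 'e::real_normed_vector) chart set \<Rightarrow> ('m \<Rightarrow> 'm) \<Rightarrow> 'm \<Rightarrow> ('m, 'e) tangent \<Rightarrow>
   ('m, 'e) tangent" where
  "pushforward A f p X = (let c = (SOME c. c \<in> charts_at A p) in
     (\<lambda>c'. if c' \<in> charts_at A (f p)
        then frechet_derivative (in_chart c (snd c' \<circ> f)) (at (snd c p)) (X c) else 0))"

definition complex_structure :: "('m, complex ^ 'n) tangent \<Rightarrow> ('m, complex ^ 'n) tangent" where
  "complex_structure X = (\<lambda>c. \<i> *s X c)"

section \<open>Strongly pseudoconvex domains\<close>

definition domain_with_defining_function ::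
  "('m::topological_space, complex ^ 'n) chart set \<Rightarrow> ('m \<Rightarrow> real) \<Rightarrow> 'm set \<Rightarrow> 'm set \<Rightarrow> bool" where
  "domain_with_defining_function A \<rho> M bM \<longleftrightarrow>
     smooth_map_on A real_atlas UNIV \<rho> \<and> M = {x. \<rho> x < 0} \<and> bM = {x. \<rho> x = 0} \<and> bM \<noteq> {} \<and>
     (\<forall>x\<in>bM. \<exists>X\<in>tangent_space A x. differential A \<rho> x X \<noteq> 0)"

definition levi_form ::
  "('m, complex ^ 'n) chart \<Rightarrow> ('m \<Rightarrow> real) \<Rightarrow> 'm \<Rightarrow> complex ^ 'n \<Rightarrow> complex" where
  "levi_form c \<rho> x w = (\<Sum>j\<in>UNIV. \<Sum>k\<in>UNIV.
     wirtinger_z j (wirtinger_zbar k (in_chart c (\<lambda>y. complex_of_real (\<rho> y)))) (snd c x)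
       * (w $ j) * cnj (w $ k))"

text \<open>The Levi form of a real function is real-valued, so taking the real part is harmless.\<close>

definition strongly_pseudoconvex ::
  "('m, complex ^ 'n) chart set \<Rightarrow> ('m \<Rightarrow> real) \<Rightarrow> 'm set \<Rightarrow> bool" where
  "strongly_pseudoconvex A \<rho> bM \<longleftrightarrow> (\<forall>x\<in>bM. \<forall>c\<in>charts_at A x. \<forall>w. w \<noteq> 0 \<longrightarrow>
     (\<Sum>k\<in>UNIV. wirtinger_z k (in_chart c (\<lambda>y. complex_of_real (\<rho> y))) (snd c x) * (w $ k)) = 0 \<longrightarrow>
     Re (levi_form c \<rho> x w) > 0)"

section \<open>Lie group actions\<close>

definition lie_group ::
  "'g monoid \<Rightarrow> ('g::topological_space, 'e::real_normed_vector) chart set \<Rightarrow> bool" where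
  "lie_group G B \<longleftrightarrow> group G \<and> carrier G = UNIV \<and> smooth_atlas B \<and>
     smooth_map_on (product_atlas B B) B UNIV (\<lambda>(a, b). a \<otimes>\<^bsub>G\<^esub> b) \<and>
     smooth_map_on B B UNIV (m_inv G)"

definition free_holomorphic_action ::
  "'g monoid \<Rightarrow> ('g::topological_space, 'e::real_normed_vector) chart set \<Rightarrow>
   ('m::topological_space, complex ^ 'n) chart set \<Rightarrow> 'm set \<Rightarrow> 'm set \<Rightarrow> ('g \<Rightarrow> 'm \<Rightarrow> 'm) \<Rightarrow> bool" where
  "free_holomorphic_action G B A M bM act \<longleftrightarrow>
     group_action G (M \<union> bM) act \<and>
     smooth_map_on (product_atlas B A) A (UNIV \<times> (M \<union> bM)) (\<lambda>(a, x). act a x) \<and>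
     (\<forall>a. holomorphic_map_on A A M (act a)) \<and>
     (\<forall>a. \<forall>x\<in>M \<union> bM. act a x = x \<longrightarrow> a = \<one>\<^bsub>G\<^esub>)"

text \<open>In a local trivialization over \<open>V\<close>, the pair \<open>(\<pi>, \<tau>)\<close> is an equivariant diffeomorphism
  of the part of \<open>P\<close> over \<open>V\<close> onto the product of \<open>V\<close> with the group, and \<open>\<sigma>\<close> is its inverse.\<close>

definition principal_bundle ::
  "'g monoid \<Rightarrow> ('g::topological_space, 'e::real_normed_vector) chart set \<Rightarrow>
   ('m::topological_space, 'd::real_normed_vector) chart set \<Rightarrow> 'm set \<Rightarrow> ('g \<Rightarrow> 'm \<Rightarrow> 'm) \<Rightarrow>
   ('x::topological_space, 'f::real_normed_vector) chart set \<Rightarrow> ('m \<Rightarrow> 'x) \<Rightarrow> bool" where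
  "principal_bundle G B A P act C \<pi> \<longleftrightarrow>
     smooth_atlas C \<and> smooth_map_on A C P \<pi> \<and> \<pi> ` P = UNIV \<and>
     (\<forall>a. \<forall>x\<in>P. act a x \<in> P \<and> \<pi> (act a x) = \<pi> x) \<and>
     (\<forall>b. \<exists>V \<tau> \<sigma>. open V \<and> b \<in> V \<and>
        smooth_map_on A B {x \<in> P. \<pi> x \<in> V} \<tau> \<and>
        smooth_map_on (product_atlas C B) A (V \<times> UNIV) \<sigma> \<and>
        (\<forall>x\<in>P. \<pi> x \<in> V \<longrightarrow> \<sigma> (\<pi> x, \<tau> x) = x) \<and>
        (\<forall>y\<in>V. \<forall>a. \<sigma> (y, a) \<in> P \<and> \<pi> (\<sigma> (y, a)) = y \<and> \<tau> (\<sigma> (y, a)) = a) \<and>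
        (\<forall>x\<in>P. \<pi> x \<in> V \<longrightarrow> (\<forall>a. \<tau> (act a x) = a \<otimes>\<^bsub>G\<^esub> \<tau> x)))"

definition orbit_space ::
  "'g monoid \<Rightarrow> 'm::topological_space set \<Rightarrow> ('g \<Rightarrow> 'm \<Rightarrow> 'm) \<Rightarrow> 'm set topology" where
  "orbit_space G E act = topology (\<lambda>U. U \<subseteq> orbits G E act \<and>
     openin (top_of_set E) {x \<in> E. orbit G act x \<in> U})"

lemma openin_orbit_space:
  "openin (orbit_space G E act) U \<longleftrightarrow> U \<subseteq> orbits G E act \<and>
     openin (top_of_set E) {x \<in> E. orbit G act x \<in> U}"
proof -
  have "istopology (\<lambda>U. U \<subseteq> orbits G E act \<and>
     openin (top_of_set E) {x \<in> E. orbit G act x \<in> U})"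
    unfolding istopology_def
  proof (intro conjI allI impI)
    fix S T
    assume S: "S \<subseteq> orbits G E act \<and> openin (top_of_set E) {x \<in> E. orbit G act x \<in> S}"
      and T: "T \<subseteq> orbits G E act \<and> openin (top_of_set E) {x \<in> E. orbit G act x \<in> T}"
    show "S \<inter> T \<subseteq> orbits G E act" using S by blast
    have "{x \<in> E. orbit G act x \<in> S \<inter> T} =
       {x \<in> E. orbit G act x \<in> S} \<inter> {x \<in> E. orbit G act x \<in> T}" by blast
    then show "openin (top_of_set E) {x \<in> E. orbit G act x \<in> S \<inter> T}"
      using S T by (simp only: openin_Int)
  next
    fix K
    assume K: "\<forall>S\<in>K. S \<subseteq> orbits G E act \<and>
      openin (top_of_set E) {x \<in> E. orbit G act x \<in> S}"
    show "\<Union>K \<subseteq> orbits G E act" using K by blast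
    have "{x \<in> E. orbit G act x \<in> \<Union>K} = (\<Union>S\<in>K. {x \<in> E. orbit G act x \<in> S})" by blast
    then show "openin (top_of_set E) {x \<in> E. orbit G act x \<in> \<Union>K}"
      using K by (simp only:) (rule openin_Union, blast)
  qed
  then show ?thesis by (simp only: orbit_space_def topology_inverse')
qed

section \<open>Riemannian and Hermitian structures\<close>

type_synonym ('m, 'e) tangent_form = "'m \<Rightarrow> ('m, 'e) tangent \<Rightarrow> ('m, 'e) tangent \<Rightarrow> real"

definition riemannian_metric ::
  "('m::topological_space, 'e::real_normed_vector) chart set \<Rightarrow> 'm set \<Rightarrow>
   ('m, 'e) tangent_form \<Rightarrow> bool" where
  "riemannian_metric A M g \<longleftrightarrow>
     (\<forall>p\<in>M. \<forall>X\<in>tangent_space A p. \<forall>Y\<in>tangent_space A p. \<forall>Z\<in>tangent_space A p. \<forall>r.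
        g p (\<lambda>c. X c + Y c) Z = g p X Z + g p Y Z \<and>
        g p (\<lambda>c. r *\<^sub>R X c) Y = r * g p X Y \<and>
        g p X Y = g p Y X \<and>
        (X \<noteq> (\<lambda>c. 0) \<longrightarrow> g p X X > 0)) \<and>
     (\<forall>c\<in>A. \<forall>u v. smooth_on (snd c ` (fst c \<inter> M))
        (in_chart c (\<lambda>p. g p (tangent_of_coords A c p u) (tangent_of_coords A c p v))))"

definition J_invariant ::
  "('m, complex ^ 'n) chart set \<Rightarrow> 'm set \<Rightarrow> ('m, complex ^ 'n) tangent_form \<Rightarrow> bool" where
  "J_invariant A M g \<longleftrightarrow> (\<forall>p\<in>M. \<forall>X\<in>tangent_space A p. \<forall>Y\<in>tangent_space A p.
     g p (complex_structure X) (complex_structure Y) = g p X Y)"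

definition G_invariant ::
  "('m, 'e::real_normed_vector) chart set \<Rightarrow> 'm set \<Rightarrow> ('g \<Rightarrow> 'm \<Rightarrow> 'm) \<Rightarrow>
   ('m, 'e) tangent_form \<Rightarrow> bool" where
  "G_invariant A M act g \<longleftrightarrow>
     (\<forall>a. \<forall>p\<in>M. \<forall>X\<in>tangent_space A p. \<forall>Y\<in>tangent_space A p.
        g (act a p) (pushforward A (act a) p X) (pushforward A (act a) p Y) = g p X Y)"

text \<open>The metric on covectors at \<open>p\<close>, by transport along the isomorphism \<open>X \<mapsto> g(X, _)\<close>.\<close>

definition sharp ::
  "('m, 'e::real_normed_vector) chart set \<Rightarrow> ('m, 'e) tangent_form \<Rightarrow> 'm \<Rightarrow>
   (('m, 'e) tangent \<Rightarrow> real) \<Rightarrow> ('m, 'e) tangent" where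
  "sharp A g p \<xi> = (THE X. X \<in> tangent_space A p \<and> (\<forall>Y\<in>tangent_space A p. \<xi> Y = g p X Y))"

definition inner_\<Lambda>1 ::
  "('m, 'e::real_normed_vector) chart set \<Rightarrow> ('m, 'e) tangent_form \<Rightarrow> 'm \<Rightarrow>
   (('m, 'e) tangent \<Rightarrow> real) \<Rightarrow> (('m, 'e) tangent \<Rightarrow> real) \<Rightarrow> real" where
  "inner_\<Lambda>1 A g p \<xi> \<eta> = g p (sharp A g p \<xi>) (sharp A g p \<eta>)"

text \<open>An element \<open>X + \<i> Y\<close> of the complexified tangent space is the pair \<open>(X, Y)\<close>.\<close>

type_synonym ('m, 'e) ctangent = "('m, 'e) tangent \<times> ('m, 'e) tangent"

definition T01 :: "('m, complex ^ 'n) chart set \<Rightarrow> 'm \<Rightarrow> ('m, complex ^ 'n) ctangent set" where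
  "T01 A p = {(X, complex_structure X) | X. X \<in> tangent_space A p}"

definition hermitian_T01 ::
  "('m, complex ^ 'n) tangent_form \<Rightarrow> 'm \<Rightarrow> ('m, complex ^ 'n) ctangent \<Rightarrow>
   ('m, complex ^ 'n) ctangent \<Rightarrow> complex" where
  "hermitian_T01 g p Z W = Complex (g p (fst Z) (fst W)) (g p (complex_structure (fst Z)) (fst W))"

text \<open>A \<open>(0,1)\<close>-covector is represented by a unique \<open>Z \<in> T01\<close> via \<open>W \<mapsto> \<langle>W, Z\<rangle>\<close>. This
  correspondence is conjugate-linear, whence the order of the arguments in the dual structure.\<close>

definition sharp01 ::
  "('m, complex ^ 'n) chart set \<Rightarrow> ('m, complex ^ 'n) tangent_form \<Rightarrow> 'm \<Rightarrow>
   (('m, complex ^ 'n) ctangent \<Rightarrow> complex) \<Rightarrow> ('m, complex ^ 'n) ctangent" where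
  "sharp01 A g p \<alpha> = (THE Z. Z \<in> T01 A p \<and> (\<forall>W\<in>T01 A p. \<alpha> W = hermitian_T01 g p W Z))"

definition hermitian_\<Lambda>01 ::
  "('m, complex ^ 'n) chart set \<Rightarrow> ('m, complex ^ 'n) tangent_form \<Rightarrow> 'm \<Rightarrow>
   (('m, complex ^ 'n) ctangent \<Rightarrow> complex) \<Rightarrow> (('m, complex ^ 'n) ctangent \<Rightarrow> complex) \<Rightarrow> complex" where
  "hermitian_\<Lambda>01 A g p \<alpha> \<beta> = hermitian_T01 g p (sharp01 A g p \<beta>) (sharp01 A g p \<alpha>)"

definition complexified_differential ::
  "('m, 'e::real_normed_vector) chart set \<Rightarrow> ('m \<Rightarrow> real) \<Rightarrow> 'm \<Rightarrow> ('m, 'e) ctangent \<Rightarrow> complex" where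
  "complexified_differential A w p Z = Complex (differential A w p (fst Z)) (differential A w p (snd Z))"

text \<open>The \<open>(0,1)\<close>-part of a complex covector \<open>\<alpha>\<close> is \<open>(\<alpha> + \<i> \<alpha> \<circ> J) / 2\<close>, since \<open>J\<close>
  acts as \<open>-\<i>\<close> on \<open>T01\<close> and as \<open>\<i>\<close> on its conjugate.\<close>

definition dbar ::
  "('m, complex ^ 'n) chart set \<Rightarrow> ('m \<Rightarrow> real) \<Rightarrow> 'm \<Rightarrow> ('m, complex ^ 'n) ctangent \<Rightarrow> complex" where
  "dbar A w p Z = (complexified_differential A w p Z +
     \<i> * complexified_differential A w p (map_prod complex_structure complex_structure Z)) / 2"

section \<open>Intrinsic metrics\<close>

text \<open>Null sets are those of the smooth measure class, i.e. Lebesgue null in every chart.\<close>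

definition essentially_bounded ::
  "('m, 'e::euclidean_space) chart set \<Rightarrow> 'm set \<Rightarrow> ('m \<Rightarrow> real) \<Rightarrow> bool" where
  "essentially_bounded A S w \<longleftrightarrow>
     (\<exists>K. \<forall>c\<in>A. negligible (snd c ` {x \<in> fst c \<inter> S. \<bar>w x\<bar> > K}))"

text \<open>The intrinsic metric of a quadratic form with energy density \<open>\<Gamma>\<close>. It takes the value
  \<open>\<infinity>\<close> on points in different components. Only the values of \<open>w\<close> on \<open>M \<union> bM\<close> matter.\<close>

definition intrinsic_metric ::
  "('m::topological_space, 'e::euclidean_space) chart set \<Rightarrow> 'm set \<Rightarrow> 'm set \<Rightarrow>
   (('m \<Rightarrow> real) \<Rightarrow> 'm \<Rightarrow> real) \<Rightarrow> 'm \<Rightarrow> 'm \<Rightarrow> ereal" where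
  "intrinsic_metric A M bM \<Gamma> x y =
     (SUP w \<in> {w. essentially_bounded A (M \<union> bM) w \<and> smooth_map_on A real_atlas (M \<union> bM) w \<and>
        (\<forall>p\<in>M. \<Gamma> w p \<le> 1)}. ereal (w y - w x))"

definition d_box ::
  "('m::topological_space, complex ^ 'n) chart set \<Rightarrow> 'm set \<Rightarrow> 'm set \<Rightarrow>
   ('m, complex ^ 'n) tangent_form \<Rightarrow> 'm \<Rightarrow> 'm \<Rightarrow> ereal" where
  "d_box A M bM g =
     intrinsic_metric A M bM (\<lambda>w p. Re (hermitian_\<Lambda>01 A g p (dbar A w p) (dbar A w p)))"

definition d_LB ::
  "('m::topological_space, complex ^ 'n) chart set \<Rightarrow> 'm set \<Rightarrow> 'm set \<Rightarrow>
   ('m, complex ^ 'n) tangent_form \<Rightarrow> 'm \<Rightarrow> 'm \<Rightarrow> ereal" where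
  "d_LB A M bM g =
     intrinsic_metric A M bM (\<lambda>w p. inner_\<Lambda>1 A g p (differential A w p) (differential A w p))"

end

theory Submission
  imports Defs
begin

text \<open>
  The two intrinsic metrics are equal, because their energy densities agree at every point of
  \<open>M\<close>, so that the two suprema range over the same functions. Fix \<open>p \<in> M\<close> and a
  function \<open>w\<close> that is smooth up to the boundary, and let \<open>V\<close> be the gradient of \<open>w\<close> at \<open>p\<close>, so
  that \<open>dw(X) = g(V, X)\<close>. On \<open>T\<^sub>0\<^sub>,\<^sub>1\<close> the antiholomorphic differential of \<open>w\<close> is the restriction
  of the complexified \<open>dw\<close>, hence it takes \<open>X + \<i> J X\<close> to \<open>g(X, V) + \<i> g(J X, V)\<close>. This is the
  Hermitian product of \<open>X + \<i> J X\<close> with \<open>V + \<i> J V\<close>, which therefore represents it, and the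
  Hermitian square of \<open>V + \<i> J V\<close> has real part \<open>g(V, V) = \<langle>dw, dw\<rangle>\<close>. The factor
  relating the densities is exactly \<open>1\<close> because \<open>X + \<i> J X\<close> is given the same squared length
  as \<open>X\<close>. This is the content of \<open>energy_densities_agree\<close>.

  The work lies in the existence of \<open>V\<close>, proved in \<open>covector_representation\<close>. It needs the
  tangent space to be a finite-dimensional real vector space, and \<open>dw\<close> to be linear at \<open>p\<close>.
  The latter (\<open>differential_linear\<close>) requires \<open>w\<close> to be differentiable at \<open>p\<close>, which
  follows since \<open>M\<close> is open and extensions of \<open>w\<close> from \<open>M \<union> bM\<close> agree with \<open>w\<close> near \<open>p\<close>.
  Holomorphy of the transition maps makes their derivatives commute with \<open>\<i>\<close>, so that \<open>J\<close>
  maps the tangent space to itself.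
\<close>

section \<open>Riesz representation for a form on a subspace\<close>

text \<open>The lemma is applied to the coordinates of tangent vectors in one chart. That these form
  a subspace follows from linearity of the transition law; that they exhaust the model space
  would need its cocycle property as well. As \<open>b\<close> and \<open>f\<close> are therefore controlled on \<open>S\<close>
  only, the proof is the Gram-Schmidt process for \<open>b\<close> itself, adding one vector of a basis of
  \<open>S\<close> at a time.\<close>

lemma riesz_representation_on_subspace:
  fixes S :: "'v::euclidean_space set" and b :: "'v \<Rightarrow> 'v \<Rightarrow> real"
  assumes S: "subspace S"
    and add: "\<And>x y z. x \<in> S \<Longrightarrow> y \<in> S \<Longrightarrow> z \<in> S \<Longrightarrow> b (x + y) z = b x z + b y z"
    and scale: "\<And>r x y. x \<in> S \<Longrightarrow> y \<in> S \<Longrightarrow> b (r *\<^sub>R x) y = r * b x y"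
    and sym: "\<And>x y. x \<in> S \<Longrightarrow> y \<in> S \<Longrightarrow> b x y = b y x"
    and pos: "\<And>x. x \<in> S \<Longrightarrow> x \<noteq> 0 \<Longrightarrow> b x x > 0"
    and f_add: "\<And>x y. x \<in> S \<Longrightarrow> y \<in> S \<Longrightarrow> f (x + y) = f x + f y"
    and f_scale: "\<And>r x. x \<in> S \<Longrightarrow> f (r *\<^sub>R x) = r * f x"
  shows "\<exists>v\<in>S. \<forall>u\<in>S. f u = b v u"
proof -
  have add': "b z (x + y) = b z x + b z y" if "x \<in> S" "y \<in> S" "z \<in> S" for x y z
    using that add sym subspace_add[OF S] by metis
  have scale': "b y (r *\<^sub>R x) = r * b y x" if "x \<in> S" "y \<in> S" for r x y
    using that scale sym subspace_scale[OF S] by metis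
  define lin where "lin f \<longleftrightarrow> (\<forall>x\<in>S. \<forall>y\<in>S. f (x + y) = f x + f y) \<and>
    (\<forall>r. \<forall>x\<in>S. f (r *\<^sub>R x) = r * f x)" for f :: "'v \<Rightarrow> real"
  have step: "\<exists>v\<in>span E. \<forall>u\<in>span E. f u = b v u" if "finite E" "E \<subseteq> S" "lin f" for E f
    using that
  proof (induction E arbitrary: f rule: finite_induct)
    case empty
    have "0 \<in> S" using S by (rule subspace_0)
    then have "f 0 = 0" "b 0 0 = 0"
      using \<open>lin f\<close> scale[of 0 0 0] unfolding lin_def by (metis mult_zero_left scaleR_zero_left)+
    then show ?case by simp
  next
    case (insert a E)
    have a: "a \<in> S" and ES: "E \<subseteq> S" using insert.prems by auto
    have sub: "span E \<subseteq> S" using ES S by (rule span_minimal)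
    obtain v where v: "v \<in> span E" "\<And>u. u \<in> span E \<Longrightarrow> f u = b v u"
      using insert.IH[OF ES \<open>lin f\<close>] by blast
    have "lin (b a)" unfolding lin_def using a add' scale' by blast
    then obtain w where w: "w \<in> span E" "\<And>u. u \<in> span E \<Longrightarrow> b a u = b w u"
      using insert.IH[OF ES] by blast
    show ?case
    proof (cases "a = w")
      case True
      then have "span (insert a E) = span E" using w by (simp add: span_redundant)
      then show ?thesis using v by auto
    next
      case False
      \<comment> \<open>The component of \<open>a\<close> that is orthogonal to the span of \<open>E\<close>.\<close>
      define a' where "a' = a - w"
      have a': "a' \<in> S" "a' \<noteq> 0" using a w sub False S unfolding a'_def
        by (auto intro: subspace_diff)
      have orth: "b a' u = 0" if "u \<in> span E" for u
      proof -
        have "b a u = b (a' + w) u" by (simp add: a'_def)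
        also have "\<dots> = b a' u + b w u" using add a' w sub that by blast
        finally show ?thesis using w that by simp
      qed
      have pos': "b a' a' > 0" using pos a' by blast
      define t where "t = f a' / b a' a'"
      define v' where "v' = v + t *\<^sub>R a'"
      have "v' \<in> span (insert a E)" unfolding v'_def a'_def
        using v(1) w(1) span_mono[of E "insert a E"]
        by (intro span_add span_scale span_diff) (auto intro: span_base)
      moreover have "f x = b v' x" if x_span: "x \<in> span (insert a E)" for x
      proof -
        obtain k where k: "x - k *\<^sub>R a \<in> span E" using x_span unfolding span_insert by blast
        define y where "y = (x - k *\<^sub>R a) + k *\<^sub>R w"
        have y: "y \<in> span E" unfolding y_def using k w by (intro span_add span_scale)
        have x: "x = y + k *\<^sub>R a'" unfolding y_def a'_def by (simp add: algebra_simps)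
        have mem: "y \<in> S" "v \<in> S" "k *\<^sub>R a' \<in> S" "t *\<^sub>R a' \<in> S" "x \<in> S"
          using y v(1) sub a' S unfolding x by (auto intro: subspace_scale subspace_add)
        have "f x = b v y + k * f a'"
          using \<open>lin f\<close> mem a' v(2)[OF y] unfolding x lin_def by simp
        moreover have "b v' x = b v x + t * b a' x"
          unfolding v'_def using add scale mem a' by simp
        moreover have "b v x = b v y"
          using add'[of y "k *\<^sub>R a'" v] scale'[of a' v k] sym[of v a'] orth[OF v(1)] mem a'
          unfolding x by simp
        moreover have "b a' x = k * b a' a'"
          using add'[of y "k *\<^sub>R a'" a'] scale'[of a' a' k] orth[OF y] mem a' unfolding x by simp
        ultimately show ?thesis using pos' unfolding t_def by simp
      qed
      ultimately show ?thesis by blast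
    qed
  qed
  obtain E where E: "E \<subseteq> S" "independent E" "span E = S"
    using basis_subspace_exists[OF S] by metis
  moreover have "lin f" unfolding lin_def using f_add f_scale by blast
  ultimately show ?thesis using step[OF independent_imp_finite] by metis
qed

section \<open>Linear algebra of the tangent space\<close>

lemma transition_complex_linear:
  assumes "complex_atlas A" "c \<in> charts_at A p" "c' \<in> charts_at A p"
  shows "transition c c' differentiable (at (snd c p))"
    and "frechet_derivative (transition c c') (at (snd c p)) (a *s v) =
      a *s frechet_derivative (transition c c') (at (snd c p)) v"
proof -
  have "snd c p \<in> snd c ` (fst c \<inter> fst c')" "c \<in> A" "c' \<in> A"
    using assms by (auto simp: charts_at_def)
  then obtain D where D: "(transition c c' has_derivative D) (at (snd c p))"
      "\<And>a v. D (a *s v) = a *s D v"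
    using assms(1) unfolding complex_atlas_def vec_holomorphic_on_def by metis
  then show "transition c c' differentiable (at (snd c p))" by (auto simp: differentiable_def)
  show "frechet_derivative (transition c c') (at (snd c p)) (a *s v) =
      a *s frechet_derivative (transition c c') (at (snd c p)) v"
    using D frechet_derivative_at[OF D(1)] by metis
qed

lemma tangent_spaceI:
  assumes "\<And>c c'. c \<in> charts_at A p \<Longrightarrow> c' \<in> charts_at A p \<Longrightarrow>
      X c' = frechet_derivative (transition c c') (at (snd c p)) (X c)"
    and "\<And>c. c \<notin> charts_at A p \<Longrightarrow> X c = 0"
  shows "X \<in> tangent_space A p"
  using assms unfolding tangent_space_def by blast

lemma tangent_spaceD:
  assumes "X \<in> tangent_space A p"
  shows "c \<in> charts_at A p \<Longrightarrow> c' \<in> charts_at A p \<Longrightarrow>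
      X c' = frechet_derivative (transition c c') (at (snd c p)) (X c)"
    and "c \<notin> charts_at A p \<Longrightarrow> X c = 0"
  using assms unfolding tangent_space_def by blast+

lemma linear_transition_derivative:
  assumes "complex_atlas A" "c \<in> charts_at A p" "c' \<in> charts_at A p"
  shows "linear (frechet_derivative (transition c c') (at (snd c p)))"
  using transition_complex_linear(1)[OF assms] by (rule linear_frechet_derivative)

lemma tangent_space_add:
  assumes A: "complex_atlas A" and X: "X \<in> tangent_space A p" and Y: "Y \<in> tangent_space A p"
  shows "(\<lambda>c. X c + Y c) \<in> tangent_space A p"
proof (rule tangent_spaceI)
  fix c c' assume c: "c \<in> charts_at A p" "c' \<in> charts_at A p"
  show "X c' + Y c' = frechet_derivative (transition c c') (at (snd c p)) (X c + Y c)"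
    unfolding linear_add[OF linear_transition_derivative[OF A c]]
    using tangent_spaceD(1)[OF X c] tangent_spaceD(1)[OF Y c] by (rule arg_cong2)
qed (simp add: tangent_spaceD(2)[OF X] tangent_spaceD(2)[OF Y])

lemma tangent_space_scale:
  assumes A: "complex_atlas A" and X: "X \<in> tangent_space A p"
  shows "(\<lambda>c. r *\<^sub>R X c) \<in> tangent_space A p"
proof (rule tangent_spaceI)
  fix c c' assume c: "c \<in> charts_at A p" "c' \<in> charts_at A p"
  show "r *\<^sub>R X c' = frechet_derivative (transition c c') (at (snd c p)) (r *\<^sub>R X c)"
    unfolding linear_scale[OF linear_transition_derivative[OF A c]]
    using tangent_spaceD(1)[OF X c] by (rule arg_cong)
qed (simp add: tangent_spaceD(2)[OF X])

lemma tangent_space_complex_structure: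
  assumes A: "complex_atlas A" and X: "X \<in> tangent_space A p"
  shows "complex_structure X \<in> tangent_space A p"
  unfolding complex_structure_def
proof (rule tangent_spaceI)
  fix c c' assume c: "c \<in> charts_at A p" "c' \<in> charts_at A p"
  show "\<i> *s X c' = frechet_derivative (transition c c') (at (snd c p)) (\<i> *s X c)"
    unfolding transition_complex_linear(2)[OF A c]
    using tangent_spaceD(1)[OF X c] by (rule arg_cong)
qed (simp add: tangent_spaceD(2)[OF X])

lemma zero_in_tangent_space:
  assumes "complex_atlas A"
  shows "(\<lambda>c. 0) \<in> tangent_space A p"
  by (rule tangent_spaceI) (simp_all add: linear_0[OF linear_transition_derivative[OF assms]])

lemma tangent_eqI:
  assumes X: "X \<in> tangent_space A p" and Y: "Y \<in> tangent_space A p"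
    and c: "c \<in> charts_at A p" and eq: "X c = Y c"
  shows "X = Y"
proof
  fix c'
  show "X c' = Y c'"
  proof (cases "c' \<in> charts_at A p")
    case True
    then show ?thesis
      using tangent_spaceD(1)[OF X c True] tangent_spaceD(1)[OF Y c True] eq by argo
  next
    case False
    then show ?thesis using tangent_spaceD(2)[OF X] tangent_spaceD(2)[OF Y] by simp
  qed
qed

lemma complex_structure_twice: "complex_structure (complex_structure X) = (\<lambda>c. (-1) *\<^sub>R X c)"
  by (auto simp: complex_structure_def vec_eq_iff fun_eq_iff)

lemma chart_at_exists:
  assumes "complex_atlas A"
  shows "(SOME c. c \<in> charts_at A p) \<in> charts_at A p"
proof -
  have "p \<in> (\<Union>c\<in>A. fst c)"
    using assms unfolding complex_atlas_def topological_atlas_def by blast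
  then have "\<exists>c. c \<in> charts_at A p" unfolding charts_at_def by blast
  then show ?thesis by (rule someI_ex)
qed

lemma riemannian_metricD:
  assumes "riemannian_metric A M g" "p \<in> M" "X \<in> tangent_space A p" "Y \<in> tangent_space A p"
  shows "Z \<in> tangent_space A p \<Longrightarrow> g p (\<lambda>c. X c + Y c) Z = g p X Z + g p Y Z"
    and "g p (\<lambda>c. r *\<^sub>R X c) Y = r * g p X Y"
    and "g p X Y = g p Y X"
    and "X \<noteq> (\<lambda>c. 0) \<Longrightarrow> g p X X > 0"
  using assms unfolding riemannian_metric_def by blast+

lemma metric_nondegenerate:
  assumes "complex_atlas A" "riemannian_metric A M g" "p \<in> M"
    and V: "V \<in> tangent_space A p" and W: "W \<in> tangent_space A p"
    and eq: "\<And>Y. Y \<in> tangent_space A p \<Longrightarrow> g p V Y = g p W Y"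
  shows "V = W"
proof (rule ccontr)
  assume "V \<noteq> W"
  define N where "N = (\<lambda>c. (-1) *\<^sub>R W c)"
  define D where "D = (\<lambda>c. V c + N c)"
  have N: "N \<in> tangent_space A p"
    unfolding N_def using assms by (intro tangent_space_scale)
  then have D: "D \<in> tangent_space A p"
    unfolding D_def using assms by (intro tangent_space_add)
  have "D \<noteq> (\<lambda>c. 0)" using \<open>V \<noteq> W\<close> unfolding D_def N_def by (auto simp: fun_eq_iff)
  then have "g p D D > 0" using assms(2,3) D by (intro riemannian_metricD(4))
  moreover have "g p D D = g p V D + g p N D"
    unfolding D_def by (intro riemannian_metricD(1)[OF assms(2,3) V N] D[unfolded D_def])
  moreover have "g p N D = - g p W D"
    unfolding N_def using riemannian_metricD(2)[OF assms(2,3) W D, of "-1"] by simp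
  ultimately show False using eq[OF D] by simp
qed

lemma covector_representation:
  assumes A: "complex_atlas A" and g: "riemannian_metric A M g" and p: "p \<in> M"
    and add: "\<And>X Y. X \<in> tangent_space A p \<Longrightarrow> Y \<in> tangent_space A p \<Longrightarrow>
      \<xi> (\<lambda>c. X c + Y c) = \<xi> X + \<xi> Y"
    and scale: "\<And>r X. X \<in> tangent_space A p \<Longrightarrow> \<xi> (\<lambda>c. r *\<^sub>R X c) = r * \<xi> X"
  shows "\<exists>V\<in>tangent_space A p. \<forall>Y\<in>tangent_space A p. \<xi> Y = g p V Y"
proof -
  define c where "c = (SOME c. c \<in> charts_at A p)"
  have c: "c \<in> charts_at A p" unfolding c_def using A by (rule chart_at_exists)
  let ?T = "tangent_space A p"
  define S where "S = (\<lambda>X. X c) ` ?T"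
  \<comment> \<open>A tangent vector is recovered from its coordinates in \<open>c\<close> by \<open>\<theta>\<close>.\<close>
  define \<theta> where "\<theta> u = inv_into ?T (\<lambda>X. X c) u" for u
  have inj: "inj_on (\<lambda>X. X c) ?T" using c by (auto intro: inj_onI tangent_eqI)
  have \<theta>_coord: "\<theta> (X c) = X" if "X \<in> ?T" for X
    unfolding \<theta>_def using inv_into_f_f[OF inj that] .
  have \<theta>: "\<theta> u \<in> ?T" "\<theta> u c = u" if "u \<in> S" for u
    using that \<theta>_coord unfolding S_def by auto
  have \<theta>_add: "\<theta> (u + v) = (\<lambda>d. \<theta> u d + \<theta> v d)" if "u \<in> S" "v \<in> S" for u v
    using \<theta>_coord[OF tangent_space_add[OF A \<theta>(1)[OF that(1)] \<theta>(1)[OF that(2)]]] \<theta>(2) that by simp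
  have \<theta>_scale: "\<theta> (r *\<^sub>R u) = (\<lambda>d. r *\<^sub>R \<theta> u d)" if "u \<in> S" for r u
    using \<theta>_coord[OF tangent_space_scale[OF A \<theta>(1)[OF that]]] \<theta>(2) that by simp
  have sub: "subspace S"
  proof (rule subspaceI)
    show "0 \<in> S" unfolding S_def using zero_in_tangent_space[OF A] by (force intro: rev_image_eqI)
    show "u + v \<in> S" if "u \<in> S" "v \<in> S" for u v
      using that tangent_space_add[OF A] unfolding S_def by (force intro: rev_image_eqI)
    show "r *\<^sub>R u \<in> S" if "u \<in> S" for u r
      using that tangent_space_scale[OF A] unfolding S_def by (force intro: rev_image_eqI)
  qed
  have "\<exists>v\<in>S. \<forall>u\<in>S. \<xi> (\<theta> u) = g p (\<theta> v) (\<theta> u)"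
  proof (rule riesz_representation_on_subspace[OF sub])
    show "g p (\<theta> u) (\<theta> u) > 0" if "u \<in> S" "u \<noteq> 0" for u
    proof (rule riemannian_metricD(4)[OF g p])
      show "\<theta> u \<noteq> (\<lambda>c. 0)" using \<theta>(2)[OF that(1)] that(2) by auto
    qed (use \<theta>(1) that in auto)
    show "g p (\<theta> u) (\<theta> v) = g p (\<theta> v) (\<theta> u)" if "u \<in> S" "v \<in> S" for u v
      using riemannian_metricD(3)[OF g p] \<theta>(1) that by blast
  qed (use \<theta>(1) in \<open>auto simp: \<theta>_add \<theta>_scale add scale
        riemannian_metricD(1,2)[OF g p]\<close>)
  then obtain v where "v \<in> S" and v: "\<And>u. u \<in> S \<Longrightarrow> \<xi> (\<theta> u) = g p (\<theta> v) (\<theta> u)" by blast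
  have "\<xi> Y = g p (\<theta> v) Y" if "Y \<in> ?T" for Y
    using v[of "Y c"] \<theta>_coord[OF that] that unfolding S_def by auto
  then show ?thesis using \<theta>(1)[OF \<open>v \<in> S\<close>] by blast
qed

section \<open>Differentials of smooth functions\<close>

lemma real_smooth_mapD:
  assumes "smooth_map_on A real_atlas S w" "p \<in> S"
  obtains c W F where "c \<in> A" "open W" "p \<in> W" "W \<subseteq> fst c" "smooth_on (snd c ` W) F"
    "\<And>x. x \<in> W \<Longrightarrow> x \<in> S \<Longrightarrow> w x = F (snd c x)"
proof -
  obtain c W F where "c \<in> A" "open W" "p \<in> W" "W \<subseteq> fst c" "smooth_on (snd c ` W) F"
    "\<forall>x\<in>W \<inter> S. F (snd c x) = w x"
    using assms unfolding smooth_map_on_def by auto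
  then show thesis by (intro that) auto
qed

lemma smooth_on_differentiable:
  assumes "smooth_on S f" "x \<in> S"
  shows "f differentiable (at x)"
proof -
  have "Ck_on (Suc 0) S f" using assms(1) unfolding smooth_on_def by blast
  then show ?thesis using assms(2) by simp
qed

lemma complex_atlas_chart:
  assumes "complex_atlas A" "c \<in> A"
  shows "is_chart c"
  using assms unfolding complex_atlas_def topological_atlas_def by blast

lemma chart_image_open:
  assumes "is_chart c" "open U" "U \<subseteq> fst c"
  shows "open (snd c ` U)"
proof -
  have "homeomorphism (fst c) (snd c ` fst c) (snd c) (inv_into (fst c) (snd c))"
    using assms(1) unfolding is_chart_def by blast
  moreover have "openin (top_of_set (fst c)) U"
    using assms(2,3) by (simp add: open_subset)
  ultimately have "openin (top_of_set (snd c ` fst c)) (snd c ` U)"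
    by (rule homeomorphism_imp_open_map)
  then show ?thesis
    using assms(1) openin_open_eq unfolding is_chart_def by blast
qed

lemma chart_inv:
  assumes "is_chart c" "x \<in> fst c"
  shows "inv_into (fst c) (snd c) (snd c x) = x"
  using assms unfolding is_chart_def homeomorphism_def by blast

lemma continuous_smooth_function:
  fixes A :: "('m::t2_space, complex ^ 'n) chart set"
  assumes A: "complex_atlas A" and w: "smooth_map_on A real_atlas UNIV w"
  shows "continuous_on UNIV w"
proof -
  have "isCont w p" for p
  proof -
    obtain c W F where cW: "c \<in> A" "open W" "p \<in> W" "W \<subseteq> fst c" "smooth_on (snd c ` W) F"
      and "\<And>x. x \<in> W \<Longrightarrow> x \<in> UNIV \<Longrightarrow> w x = F (snd c x)"
      using w UNIV_I[of p] by (rule real_smooth_mapD) blast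
    then have eq: "\<And>x. x \<in> W \<Longrightarrow> w x = F (snd c x)" by blast
    have "Ck_on 0 (snd c ` W) F" using cW(5) unfolding smooth_on_def by blast
    then have F: "continuous_on (snd c ` W) F" by simp
    have "homeomorphism (fst c) (snd c ` fst c) (snd c) (inv_into (fst c) (snd c))"
      using complex_atlas_chart[OF A cW(1)] unfolding is_chart_def by blast
    then have "continuous_on W (snd c)"
      using homeomorphism_cont1 continuous_on_subset cW(4) by blast
    then have "continuous_on W (\<lambda>x. F (snd c x))"
      by (rule continuous_on_compose2[OF F]) simp
    moreover have "continuous_on W w \<longleftrightarrow> continuous_on W (\<lambda>x. F (snd c x))"
      using refl eq by (rule continuous_on_cong)
    ultimately have "continuous_on W w" by blast
    then show "isCont w p" using cW(2,3) by (simp add: continuous_on_eq_continuous_at)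
  qed
  then show ?thesis by (simp add: continuous_at_imp_continuous_on)
qed

text \<open>A function smooth up to the boundary comes with an extension in some chart near \<open>p\<close>, while
  the differential is computed in an arbitrary one, so the two have to be compared by a
  transition map.\<close>

lemma in_chart_differentiable:
  assumes A: "complex_atlas A" and w: "smooth_map_on A real_atlas S w"
    and M: "open M" "M \<subseteq> S" "p \<in> M" and c: "c \<in> charts_at A p"
  shows "in_chart c w differentiable (at (snd c p))"
proof -
  obtain c0 W F where cW: "c0 \<in> A" "open W" "p \<in> W" "W \<subseteq> fst c0" "smooth_on (snd c0 ` W) F"
    and eq: "\<And>x. x \<in> W \<Longrightarrow> x \<in> S \<Longrightarrow> w x = F (snd c0 x)"
    using w subsetD[OF M(2,3)] by (rule real_smooth_mapD) blast
  have c0: "c0 \<in> charts_at A p" using cW unfolding charts_at_def by auto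
  have chart: "is_chart c" and pc: "p \<in> fst c"
    using c complex_atlas_chart[OF A] unfolding charts_at_def by auto
  define U where "U = fst c \<inter> W \<inter> M"
  have "open U" using chart cW M unfolding U_def is_chart_def by blast
  then have open_im: "open (snd c ` U)" using chart unfolding U_def by (intro chart_image_open) auto
  have pU: "p \<in> U" using pc cW M unfolding U_def by blast
  have trans: "transition c c0 (snd c p) = snd c0 p"
    using chart_inv[OF chart pc] by (simp add: in_chart_def)
  obtain D where D: "(transition c c0 has_derivative D) (at (snd c p))"
    using transition_complex_linear(1)[OF A c c0] unfolding differentiable_def by blast
  obtain D' where "(F has_derivative D') (at (transition c c0 (snd c p)))"
    using smooth_on_differentiable[OF cW(5)] cW(3) unfolding trans differentiable_def by blast
  with D have comp: "(F \<circ> transition c c0 has_derivative D' \<circ> D) (at (snd c p))"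
    by (rule diff_chain_at)
  have "(in_chart c w has_derivative D' \<circ> D) (at (snd c p))"
  proof (rule has_derivative_transform_within_open[OF comp open_im])
    show "snd c p \<in> snd c ` U" using pU by blast
    fix z assume "z \<in> snd c ` U"
    then obtain x where x: "x \<in> U" "z = snd c x" by blast
    then have "inv_into (fst c) (snd c) z = x" using chart_inv[OF chart] unfolding U_def by auto
    then show "(F \<circ> transition c c0) z = in_chart c w z"
      using x eq[of x] M(2) unfolding U_def in_chart_def by auto
  qed
  then show ?thesis unfolding differentiable_def by blast
qed

lemma differential_linear:
  assumes "complex_atlas A" "smooth_map_on A real_atlas S w" "open M" "M \<subseteq> S" "p \<in> M"
  shows "differential A w p (\<lambda>c. X c + Y c) = differential A w p X + differential A w p Y"
    and "differential A w p (\<lambda>c. r *\<^sub>R X c) = r * differential A w p X"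
proof -
  have lin: "linear (frechet_derivative (in_chart c w) (at (snd c p)))"
    if "c = (SOME c. c \<in> charts_at A p)" for c
    unfolding that
    by (intro linear_frechet_derivative in_chart_differentiable[OF assms] chart_at_exists assms(1))
  show "differential A w p (\<lambda>c. X c + Y c) = differential A w p X + differential A w p Y"
    unfolding differential_def Let_def by (rule linear_add[OF lin[OF refl]])
  show "differential A w p (\<lambda>c. r *\<^sub>R X c) = r * differential A w p X"
    unfolding differential_def Let_def using linear_scale[OF lin[OF refl]] by simp
qed

section \<open>Comparison of the energy densities\<close>

text \<open>Here \<open>Z = X + \<i> J X\<close>, so \<open>J Z = - \<i> Z\<close> and the projection defining \<open>\<partial>\<close>-bar
  leaves the value of \<open>dw\<close> on \<open>Z\<close> unchanged.\<close>

lemma dbar_on_T01: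
  assumes "\<And>X r. differential A w p (\<lambda>c. r *\<^sub>R X c) = r * differential A w p X"
  shows "dbar A w p (X, complex_structure X) =
    Complex (differential A w p X) (differential A w p (complex_structure X))"
  using assms[of "-1" X]
  by (simp add: dbar_def complexified_differential_def complex_structure_twice complex_eq_iff)

lemma energy_densities_agree:
  assumes A: "complex_atlas A" and g: "riemannian_metric A M g" and M: "open M"
    and w: "smooth_map_on A real_atlas S w" "M \<subseteq> S" and p: "p \<in> M"
  shows "Re (hermitian_\<Lambda>01 A g p (dbar A w p) (dbar A w p)) =
    inner_\<Lambda>1 A g p (differential A w p) (differential A w p)"
proof -
  let ?T = "tangent_space A p"
  note lin = differential_linear[OF A w(1) M w(2) p]
  obtain V where V: "V \<in> ?T" "\<And>Y. Y \<in> ?T \<Longrightarrow> differential A w p Y = g p V Y"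
    using covector_representation[OF A g p, of "differential A w p"] lin by blast
  have unique: "V' = V" if "V' \<in> ?T" "\<And>Y. Y \<in> ?T \<Longrightarrow> differential A w p Y = g p V' Y" for V'
    using metric_nondegenerate[OF A g p that(1) V(1)] V(2) that(2) by metis
  have sharp: "sharp A g p (differential A w p) = V"
    unfolding sharp_def using V unique by (intro the_equality) auto
  have sharp01: "sharp01 A g p (dbar A w p) = (V, complex_structure V)"
    unfolding sharp01_def
  proof (rule the_equality, intro conjI ballI)
    show "(V, complex_structure V) \<in> T01 A p" using V(1) unfolding T01_def by blast
    fix Z assume "Z \<in> T01 A p"
    then obtain X where X: "X \<in> ?T" "Z = (X, complex_structure X)" unfolding T01_def by blast
    have JX: "complex_structure X \<in> ?T" using A X(1) by (rule tangent_space_complex_structure)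
    show "dbar A w p Z = hermitian_T01 g p Z (V, complex_structure V)"
      unfolding X(2) dbar_on_T01[OF lin(2)] hermitian_T01_def
      using V(2) riemannian_metricD(3)[OF g p] V(1) X(1) JX by simp
  next
    fix Z assume Z: "Z \<in> T01 A p \<and> (\<forall>W\<in>T01 A p. dbar A w p W = hermitian_T01 g p W Z)"
    then obtain V' where V': "V' \<in> ?T" "Z = (V', complex_structure V')" unfolding T01_def by blast
    \<comment> \<open>Already the real parts determine the representing vector.\<close>
    have "differential A w p Y = g p V' Y" if Y: "Y \<in> ?T" for Y
    proof -
      have "(Y, complex_structure Y) \<in> T01 A p" using Y unfolding T01_def by blast
      then have "dbar A w p (Y, complex_structure Y) = hermitian_T01 g p (Y, complex_structure Y) Z"
        using Z by blast
      then have "differential A w p Y = g p Y V'"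
        unfolding dbar_on_T01[OF lin(2)] hermitian_T01_def V'(2) by simp
      then show ?thesis using riemannian_metricD(3)[OF g p Y V'(1)] by simp
    qed
    then show "Z = (V, complex_structure V)" using unique V' by blast
  qed
  show ?thesis unfolding hermitian_\<Lambda>01_def inner_\<Lambda>1_def sharp sharp01 hermitian_T01_def by simp
qed

lemma d_box_eq_d_LB:
  assumes "complex_atlas A" "riemannian_metric A M g" "open M"
  shows "d_box A M bM g = d_LB A M bM g"
proof (intro ext)
  fix x y
  have "{w. essentially_bounded A (M \<union> bM) w \<and> smooth_map_on A real_atlas (M \<union> bM) w \<and>
      (\<forall>p\<in>M. Re (hermitian_\<Lambda>01 A g p (dbar A w p) (dbar A w p)) \<le> 1)} =
    {w. essentially_bounded A (M \<union> bM) w \<and> smooth_map_on A real_atlas (M \<union> bM) w \<and>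
      (\<forall>p\<in>M. inner_\<Lambda>1 A g p (differential A w p) (differential A w p) \<le> 1)}"
    using energy_densities_agree[OF assms(1,2,3), where S = "M \<union> bM"] by auto
  then show "d_box A M bM g x y = d_LB A M bM g x y"
    unfolding d_box_def d_LB_def intrinsic_metric_def by simp
qed

theorem proposition3p8:
  fixes A :: "('m::{t2_space, second_countable_topology}, complex ^ 'n) chart set"
    and \<rho> :: "'m \<Rightarrow> real"
    and M bM :: "'m set"
    and G :: "'g::{t2_space, second_countable_topology} monoid"
    and B :: "('g, 'e::real_normed_vector) chart set"
    and act :: "'g \<Rightarrow> 'm \<Rightarrow> 'm"
    and C :: "('x::{t2_space, second_countable_topology}, 'f::real_normed_vector) chart set"
    and \<pi> :: "'m \<Rightarrow> 'x"
    and g :: "('m, complex ^ 'n) tangent_form"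
  assumes "complex_atlas A"
    and "domain_with_defining_function A \<rho> M bM"
    and "strongly_pseudoconvex A \<rho> bM"
    and "lie_group G B"
    and "free_holomorphic_action G B A M bM act"
    and "principal_bundle G B A M act C \<pi>"
    and "compact_space (orbit_space G (M \<union> bM) act)"
    and "riemannian_metric A M g"
    and "G_invariant A M act g"
    and "J_invariant A M g"
  shows "\<exists>c > 0. \<exists>C > 0. \<forall>x\<in>M. \<forall>y\<in>M.
           ereal c * d_LB A M bM g x y \<le> d_box A M bM g x y \<and>
           d_box A M bM g x y \<le> ereal C * d_LB A M bM g x y"
proof -
  have "smooth_map_on A real_atlas UNIV \<rho>" and M_eq: "M = {x. \<rho> x < 0}"
    using assms(2) unfolding domain_with_defining_function_def by auto
  then have "continuous_on UNIV \<rho>" using continuous_smooth_function[OF assms(1)] by blast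
  then have "open M" unfolding M_eq by (intro open_Collect_less continuous_on_const)
  then have "d_box A M bM g = d_LB A M bM g" using assms by (intro d_box_eq_d_LB)
  then show ?thesis by (auto simp flip: one_ereal_def intro!: exI[of _ 1])
qed

end
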